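(* Let $M=(\mathcal{L},r)$ be a matroid or a $q$-matroid and let $\mathcal{P}$ be a Tutte partition of $M$. Then $$\beta_q*\rho(M;x,y)=\tau_{\mathcal{P}}(M;x,y).$$ In particular, the Tutte polynomial $\tau_{\mathcal{P}}(M;x,y)$ of $M$ is independent of the choice of Tutte partition $\mathcal{P}$.
   Context: A matroid or $q$-matroid is a pair $M=(\mathcal{L},r)$, where $\mathcal{L}$ is either the Boolean lattice of all subsets of a finite set (matroid case) or the lattice of all subspaces of a finite-dimensional vector space over $\mathbb{F}_q$, $q$ a prime power ($q$-matroid case), ordered by inclusion with meet $\wedge$ and join $\vee$. In the matroid case, formulas involving $q$ are read with $q=1$. $\mathrm{h}(x)$ is the cardinality, respectively dimension, of $x$; $\mathbf{0},\mathbf{1}$ are the least and greatest elements of $\mathcal{L}$. The function $r:\mathcal{L}\to\mathbb{Z}_{\ge 0}$ satisfies: $0\le r(x)\le \mathrm{h}(x)$; $x\le y\Rightarrow r(x)\le r(y)$; $r(x\vee y)+r(x\wedge y)\le r(x)+r(y)$. The nullity is $\nu(x)=\mathrm{h}(x)-r(x)$. A diamond is an interval $[a,b]$ with $\mathrm{h}(b)-\mathrm{h}(a)=2$; it is prime if $r(x)-r(a)=1$ and $r(b)-r(x)=0$ for every $a<x<b$. An interval is prime-free if it contains no prime diamond as a subinterval. A Tutte partition of $M$ is a partition $\mathcal{P}$ of the set $\mathcal{L}$ into intervals such that for every $[a,b]\in\mathcal{P}$: $r(a)=\mathrm{h}(a)$, $r(b)=r(\mathbf{1})$, and $[a,b]$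 is prime-free. The Tutte polynomial of $M$ with respect to a Tutte partition $\mathcal{P}$ is $$\tau_{\mathcal{P}}(M;x,y)=\sum_{[a,b]\in\mathcal{P}}x^{r(b)-r(a)}y^{\nu(b)-\nu(a)}.$$ The rank generating polynomial is $\rho(M;x,y)=\sum_{z\in\mathcal{L}}x^{r(\mathbf{1})-r(z)}y^{\nu(z)}\in\mathbb{Z}[x,y]$. Let $$\beta_q(a,b;c,d):=(-1)^{(a-c)+(b-d)}\left[\begin{matrix}a\\c\end{matrix}\right]_q\left[\begin{matrix}b\\d\end{matrix}\right]_q q^{\binom{|(a-c)-(b-d)|}{2}}\bigl(1+q^{|(a-c)-(b-d)|}-q^{\max(a-c,\,b-d)}\bigr)$$ ($q$-binomial coefficients), and for $P=\sum_{i,j}p_{i,j}x^iy^j\in\mathbb{Z}[x,y]$ set $\beta_q*P:=\sum_{i,j}p_{i,j}\sum_{a=0}^{i}\sum_{b=0}^{j}\beta_q(i,j;a,b)x^ay^b$. *)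

theory Defs
  imports "HOL-Computational_Algebra.Polynomial" "HOL-Library.Disjoint_Sets"
    "HOL-Library.Cardinality"
begin

section \<open>Matroids and q-matroids\<close>

text \<open>
  The Boolean lattice and the lattice of subspaces are both treated as a family \<open>L\<close> of sets
  ordered by inclusion, in which the meet is the intersection. The join and the height
  (cardinality or dimension) are passed as parameters.
\<close>

definition rank_function ::
  "'a set set \<Rightarrow> ('a set \<Rightarrow> 'a set \<Rightarrow> 'a set) \<Rightarrow> ('a set \<Rightarrow> nat) \<Rightarrow> ('a set \<Rightarrow> nat) \<Rightarrow> bool" where
  "rank_function L join h r \<longleftrightarrow>
     (\<forall>x\<in>L. r x \<le> h x) \<and>
     (\<forall>x\<in>L. \<forall>y\<in>L. x \<subseteq> y \<longrightarrow> r x \<le> r y) \<and>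
     (\<forall>x\<in>L. \<forall>y\<in>L. r (join x y) + r (x \<inter> y) \<le> r x + r y)"

locale matroid =
  fixes E :: "'a set" and r :: "'a set \<Rightarrow> nat"
  assumes finite_ground: "finite E"
    and rank: "rank_function (Pow E) (\<union>) card r"

locale q_matroid = finite_dimensional_vector_space scale Basis
  for scale :: "'k::{field,finite} \<Rightarrow> 'v::ab_group_add \<Rightarrow> 'v" and Basis :: "'v set" +
  fixes r :: "'v set \<Rightarrow> nat"
  assumes rank: "rank_function {U. subspace U} (\<lambda>U W. span (U \<union> W)) dim r"

definition subspaces :: "('k::field \<Rightarrow> 'v::ab_group_add \<Rightarrow> 'v) \<Rightarrow> 'v set set" where
  "subspaces scale = {U. module.subspace scale U}"


section \<open>Tutte partitions\<close>

definition nullity :: "('a set \<Rightarrow> nat) \<Rightarrow> ('a set \<Rightarrow> nat) \<Rightarrow> 'a set \<Rightarrow> nat" where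
  "nullity h r x = h x - r x"

definition interval :: "'a set set \<Rightarrow> 'a set \<Rightarrow> 'a set \<Rightarrow> 'a set set" where
  "interval L a b = {z \<in> L. a \<subseteq> z \<and> z \<subseteq> b}"

definition prime_diamond ::
  "'a set set \<Rightarrow> ('a set \<Rightarrow> nat) \<Rightarrow> ('a set \<Rightarrow> nat) \<Rightarrow> 'a set \<Rightarrow> 'a set \<Rightarrow> bool" where
  "prime_diamond L h r a b \<longleftrightarrow>
     a \<in> L \<and> b \<in> L \<and> a \<subseteq> b \<and> h b = h a + 2 \<and>
     (\<forall>x\<in>L. a \<subset> x \<and> x \<subset> b \<longrightarrow> r x = r a + 1 \<and> r b = r x)"

definition prime_free ::
  "'a set set \<Rightarrow> ('a set \<Rightarrow> nat) \<Rightarrow> ('a set \<Rightarrow> nat) \<Rightarrow> 'a set \<Rightarrow> 'a set \<Rightarrow> bool" where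
  "prime_free L h r a b \<longleftrightarrow> \<not> (\<exists>c d. a \<subseteq> c \<and> d \<subseteq> b \<and> prime_diamond L h r c d)"

text \<open>
  A partition into intervals is given by the set of the pairs of endpoints of its blocks; as
  \<open>a \<subseteq> b\<close> is required, the endpoints are determined by the block. In both lattices the greatest
  element is \<open>\<Union>L\<close>.
\<close>

definition tutte_partition ::
  "'a set set \<Rightarrow> ('a set \<Rightarrow> nat) \<Rightarrow> ('a set \<Rightarrow> nat) \<Rightarrow> ('a set \<times> 'a set) set \<Rightarrow> bool" where
  "tutte_partition L h r P \<longleftrightarrow>
     partition_on L ((\<lambda>(a, b). interval L a b) ` P) \<and>
     (\<forall>(a, b)\<in>P. a \<in> L \<and> b \<in> L \<and> a \<subseteq> b \<and>
        r a = h a \<and> r b = r (\<Union>L) \<and> prime_free L h r a b)"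


section \<open>The polynomials\<close>

text \<open>
  The ring \<open>\<int>[x,y]\<close> is \<open>int poly poly\<close>: the outer variable is \<open>x\<close>, the inner one is \<open>y\<close>, so the
  coefficient of \<open>x^i y^j\<close> in \<open>p\<close> is \<open>coeff (coeff p i) j\<close>.
\<close>

definition var_x :: "int poly poly" where "var_x = [:0, 1:]"

definition var_y :: "int poly poly" where "var_y = [:[:0, 1:]:]"

lemma coeff_monomial_xy:
  "coeff (coeff (of_int c * var_x ^ i * var_y ^ j) k) l = (if k = i \<and> l = j then c else 0)"
proof -
  have x: "var_x ^ i = monom 1 i"
    by (simp add: var_x_def monom_altdef)
  have y: "var_y ^ j = [:monom 1 j:]"
  proof (induction j)
    case (Suc j)
    then show ?case by (simp add: var_y_def monom_Suc)
  qed (simp add: monom_0 one_pCons)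
  have "of_int c * var_x ^ i * var_y ^ j = monom (monom c j) i"
    by (simp add: x y of_int_poly smult_monom)
  then show ?thesis by auto
qed

text \<open>The exponents below are differences of monotone functions, so no subtraction is truncated.\<close>

definition tutte_poly ::
  "('a set \<Rightarrow> nat) \<Rightarrow> ('a set \<Rightarrow> nat) \<Rightarrow> ('a set \<times> 'a set) set \<Rightarrow> int poly poly" where
  "tutte_poly h r P =
     (\<Sum>(a, b)\<in>P. var_x ^ (r b - r a) * var_y ^ (nullity h r b - nullity h r a))"

definition rank_gen_poly ::
  "'a set set \<Rightarrow> ('a set \<Rightarrow> nat) \<Rightarrow> ('a set \<Rightarrow> nat) \<Rightarrow> int poly poly" where
  "rank_gen_poly L h r = (\<Sum>z\<in>L. var_x ^ (r (\<Union>L) - r z) * var_y ^ nullity h r z)"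


section \<open>The operation of \<open>\<beta>\<^sub>q\<close>\<close>

text \<open>
  The quotient of \<open>q\<close>-factorials also makes sense for \<open>q = 1\<close>, where it is the ordinary
  binomial coefficient. The division is exact by \<open>q_binomial_exact\<close> below.
\<close>

definition q_int :: "nat \<Rightarrow> nat \<Rightarrow> nat" where
  "q_int q n = (\<Sum>i<n. q ^ i)"

definition q_fact :: "nat \<Rightarrow> nat \<Rightarrow> nat" where
  "q_fact q n = (\<Prod>i=1..n. q_int q i)"

definition q_binomial :: "nat \<Rightarrow> nat \<Rightarrow> nat \<Rightarrow> nat" where
  "q_binomial q n k = (if k \<le> n then q_fact q n div (q_fact q k * q_fact q (n - k)) else 0)"

lemma q_fact_dvd: "q_fact q m * q_fact q n dvd q_fact q (m + n)"
proof (induction "m + n" arbitrary: m n)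
  case 0
  then show ?case by (simp add: q_fact_def)
next
  case (Suc s)
  have q_int_add: "q_int q (i + j) = q_int q i + q ^ i * q_int q j" for i j
    by (induction j) (simp_all add: q_int_def power_add algebra_simps)
  have q_fact_Suc: "q_fact q (Suc i) = q_fact q i * q_int q (Suc i)" for i
    by (simp add: q_fact_def)
  show ?case
  proof (cases "m = 0 \<or> n = 0")
    case True
    then show ?thesis by (auto simp: q_fact_def)
  next
    case False
    then obtain m' n' where mn: "m = Suc m'" "n = Suc n'"
      using not0_implies_Suc by blast
    have 1: "q_fact q m' * q_fact q n dvd q_fact q s"
      using Suc.hyps(1)[of m' n] Suc.hyps(2) mn by simp
    have 2: "q_fact q m * q_fact q n' dvd q_fact q s"
      using Suc.hyps(1)[of m n'] Suc.hyps(2) mn by simp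
    have "q_fact q (m + n) = q_fact q s * q_int q m + q_fact q s * (q ^ m * q_int q n)"
      using Suc.hyps(2) q_fact_Suc[of s] q_int_add[of m n] by (simp add: algebra_simps)
    moreover have "q_fact q m * q_fact q n dvd q_fact q s * q_int q m"
      using mult_dvd_mono[OF 1 dvd_refl[of "q_int q m"]] q_fact_Suc[of m'] mn
      by (simp add: ac_simps)
    moreover have "q_fact q m * q_fact q n dvd q_fact q s * (q ^ m * q_int q n)"
      using mult_dvd_mono[OF 2 dvd_triv_right[of "q_int q n" "q ^ m"]] q_fact_Suc[of n'] mn
      by (simp add: ac_simps)
    ultimately show ?thesis by simp
  qed
qed

lemma q_binomial_exact:
  "k \<le> n \<Longrightarrow> q_binomial q n k * (q_fact q k * q_fact q (n - k)) = q_fact q n"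
  using q_fact_dvd[of q k "n - k"] by (simp add: q_binomial_def)

lemma q_binomial_1: "q_binomial 1 n k = n choose k"
proof -
  have "q_fact 1 m = fact m" for m
    by (simp add: q_fact_def q_int_def fact_prod)
  then show ?thesis
    by (simp add: q_binomial_def binomial_eq_0
        flip: binomial_fact_lemma[of k n])
qed

definition beta_q :: "nat \<Rightarrow> nat \<Rightarrow> nat \<Rightarrow> nat \<Rightarrow> nat \<Rightarrow> int" where
  "beta_q q a b c d =
     (let e = nat \<bar>int (a - c) - int (b - d)\<bar> in
      (- 1) ^ ((a - c) + (b - d)) * int (q_binomial q a c) * int (q_binomial q b d) *
      int q ^ (e choose 2) * (1 + int q ^ e - int q ^ max (a - c) (b - d)))"

definition beta_act :: "nat \<Rightarrow> int poly poly \<Rightarrow> int poly poly" where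
  "beta_act q p =
     (\<Sum>i\<le>degree p. \<Sum>j\<le>degree (coeff p i).
        of_int (coeff (coeff p i) j) *
        (\<Sum>a\<le>i. \<Sum>b\<le>j. of_int (beta_q q i j a b) * var_x ^ a * var_y ^ b))"

end

theory Submission
  imports Defs
begin

text \<open>
  The idea is that \<open>\<beta>\<^sub>q\<close> inverts the passage from a Tutte block to its rank generating polynomial,
  and that for a prime-free block this polynomial depends only on rank and nullity.

  Every block \<open>[a, b]\<close> of a Tutte partition satisfies \<open>r a = h a\<close> and \<open>r b = r (\<Union>L)\<close>, so the part of
  the rank generating polynomial that comes from the \<open>z\<close> in the block is the rank generating
  polynomial of the minor on \<open>[a, b]\<close>. The operation of \<open>\<beta>\<^sub>q\<close> is additive, hence it suffices to
  show that it sends the polynomial of a prime-free block to \<open>x\<^sup>s y\<^sup>t\<close>, where \<open>s\<close> is the rank and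
  \<open>t\<close> the nullity of the block (\<open>beta_act_block\<close>). Since the left-hand side of the claimed identity
  does not mention the partition, its independence of the partition follows.

  A circuit of height at least \<open>2\<close> above \<open>a\<close> would be the top of a prime diamond. In a prime-free
  block all circuits are therefore loops; with \<open>l\<close> the join of all loops, the block has rank
  function \<open>r z = h a + (h z - h (z \<inter> l))\<close> (\<open>prime_free_rank\<close>), with \<open>s = h b - h l\<close> and
  \<open>t = h l - h a\<close>. The number of \<open>z\<close> of relative rank \<open>i\<close> and nullity \<open>j\<close> is
  \<open>[s,i]\<^sub>q [t,j]\<^sub>q q\<^bsup>i(t-j)\<^esup>\<close> (\<open>sum_interval_meet_heights\<close>), so that the polynomial of the block is
  the sum of \<open>[s,i]\<^sub>q [t,j]\<^sub>q q\<^bsup>(s-i)(t-j)\<^esup> x\<^sup>i y\<^sup>j\<close>. It remains to see that the coefficients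
  \<open>\<beta>\<^sub>q(i,j;c,d)\<close> form the inverse matrix (\<open>beta_orthogonality\<close>): a rewriting of the exponents of
  \<open>\<beta>\<^sub>q\<close> makes the double sum a combination of products of two single sums, which the
  \<open>q\<close>-binomial theorem evaluates.

  Both kinds of lattices are covered by one locale, whose axiom on \<open>q\<close> is that an
  interval of length \<open>n\<close> has \<open>1 + q + \<dots> + q\<^bsup>n-1\<^esup>\<close> atoms.
\<close>

section \<open>Gaussian binomial coefficients\<close>

lemma q_int_pos: "n > 0 \<Longrightarrow> q_int q n > 0"
  by (cases n) (auto simp: q_int_def lessThan_Suc_eq_insert_0)

lemma q_fact_pos: "q_fact q n > 0"
  by (auto simp: q_fact_def intro!: prod_pos q_int_pos)

lemma q_fact_Suc: "q_fact q (Suc n) = q_int q (Suc n) * q_fact q n"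
  by (simp add: q_fact_def)

lemma q_int_add: "q_int q (m + n) = q_int q m + q ^ m * q_int q n"
  by (induction n) (simp_all add: q_int_def power_add algebra_simps)

lemma q_binomial_0 [simp]: "q_binomial q n 0 = 1"
  using q_fact_pos[of q n] by (simp add: q_binomial_def) (simp add: q_fact_def)

lemma q_binomial_self [simp]: "q_binomial q n n = 1"
  using q_fact_pos[of q n] by (simp add: q_binomial_def) (simp add: q_fact_def)

lemma q_binomial_eq_0 [simp]: "n < k \<Longrightarrow> q_binomial q n k = 0"
  by (simp add: q_binomial_def)

lemma q_binomial_symmetric: "k \<le> n \<Longrightarrow> q_binomial q n (n - k) = q_binomial q n k"
  by (simp add: q_binomial_def mult.commute)

lemma q_binomial_Suc_Suc:
  "q_binomial q (Suc n) (Suc k) = q_binomial q n (Suc k) + q ^ (n - k) * q_binomial q n k"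
proof (cases "k < n")
  case False
  then show ?thesis by (cases "k = n") auto
next
  case True
  define m where "m = n - Suc k"
  have n: "n = Suc (k + m)" using True by (simp add: m_def)
  let ?F = "q_fact q (Suc k) * q_fact q (Suc m)"
  have 1: "q_binomial q n (Suc k) * ?F = q_fact q n * q_int q (Suc m)"
    using q_binomial_exact[of "Suc k" n q] by (simp add: n q_fact_Suc algebra_simps)
  have 2: "q_binomial q n k * ?F = q_fact q n * q_int q (Suc k)"
    using q_binomial_exact[of k n q] by (simp add: n q_fact_Suc algebra_simps Suc_diff_le)
  have "q_binomial q (Suc n) (Suc k) * ?F = q_fact q (Suc n)"
    using q_binomial_exact[of "Suc k" "Suc n" q] by (simp add: n Suc_diff_le)
  also have "\<dots> = q_fact q n * (q_int q (Suc m) + q ^ Suc m * q_int q (Suc k))"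
    using q_int_add[of q "Suc m" "Suc k"] by (simp add: q_fact_Suc n algebra_simps)
  also have "\<dots> = (q_binomial q n (Suc k) + q ^ Suc m * q_binomial q n k) * ?F"
    unfolding distrib_right mult.assoc 1 2 by (simp add: algebra_simps)
  finally show ?thesis
    using q_fact_pos[of q "Suc k"] q_fact_pos[of q "Suc m"] by (simp add: n Suc_diff_le)
qed

lemma q_binomial_trinomial:
  assumes "c + i \<le> s"
  shows "q_binomial q s (c + i) * q_binomial q (c + i) c = q_binomial q s c * q_binomial q (s - c) i"
proof -
  let ?F = "q_fact q c * q_fact q i * q_fact q (s - (c + i))"
  have "q_binomial q s (c + i) * q_binomial q (c + i) c * ?F
      = q_binomial q s (c + i) * (q_binomial q (c + i) c * (q_fact q c * q_fact q (c + i - c)))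
          * q_fact q (s - (c + i))"
    by (simp add: algebra_simps)
  also have "\<dots> = q_fact q s"
    using q_binomial_exact[of "c + i" s q] assms
    by (subst q_binomial_exact) (simp_all add: algebra_simps)
  also have "\<dots> = q_binomial q s c * (q_fact q c *
       (q_binomial q (s - c) i * (q_fact q i * q_fact q (s - c - i))))"
    using q_binomial_exact[of i "s - c" q] q_binomial_exact[of c s q] assms by simp
  also have "\<dots> = q_binomial q s c * q_binomial q (s - c) i * ?F"
    by (simp add: algebra_simps)
  finally show ?thesis
    using q_fact_pos[of q] by (metis mult_right_cancel mult_eq_0_iff less_numeral_extra(3))
qed

text \<open>
  The \<open>q\<close>-Pascal rule in summed form, with an arbitrary weight. It is the induction step both of
  the \<open>q\<close>-binomial theorem and of the counts in lattice intervals.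
\<close>

lemma sum_q_binomial_Suc:
  fixes c :: "nat \<Rightarrow> 'r::comm_semiring_1"
  shows "(\<Sum>i\<le>Suc n. of_nat (q_binomial q (Suc n) i) * c i)
       = (\<Sum>i\<le>n. of_nat (q_binomial q n i) * (c i + of_nat q ^ (n - i) * c (Suc i)))"
proof -
  have "(\<Sum>i\<le>Suc n. of_nat (q_binomial q (Suc n) i) * c i)
      = c 0 + (\<Sum>i\<le>n. of_nat (q_binomial q n (Suc i)) * c (Suc i))
        + (\<Sum>i\<le>n. of_nat (q_binomial q n i) * (of_nat q ^ (n - i) * c (Suc i)))"
    unfolding sum.atMost_Suc_shift
    by (simp add: q_binomial_Suc_Suc algebra_simps sum.distrib del: sum.atMost_Suc)
  also have "c 0 + (\<Sum>i\<le>n. of_nat (q_binomial q n (Suc i)) * c (Suc i))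
      = (\<Sum>i\<le>Suc n. of_nat (q_binomial q n i) * c i)"
    by (subst sum.atMost_Suc_shift) simp
  also have "\<dots> = (\<Sum>i\<le>n. of_nat (q_binomial q n i) * c i)"
    by simp
  finally show ?thesis
    by (simp add: sum.distrib distrib_left)
qed

lemma q_binomial_theorem:
  fixes z :: real
  shows "(\<Sum>i\<le>m. real (q_binomial q m i) * ((- 1) ^ i * real q ^ (i choose 2) * z ^ i))
       = (\<Prod>k<m. 1 - z * real q ^ k)"
proof (induction m)
  case (Suc m)
  let ?c = "\<lambda>i. (- 1) ^ i * real q ^ (i choose 2) * z ^ i"
  have step: "real q ^ (m - i) * ?c (Suc i) = - (z * real q ^ m) * ?c i" if "i \<le> m" for i
  proof -
    have "real q ^ (m - i) * real q ^ (Suc i choose 2) = real q ^ m * real q ^ (i choose 2)"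
      using that by (simp add: numeral_2_eq_2 flip: power_add)
    then show ?thesis by (simp add: algebra_simps)
  qed
  have alg: "x + y = x * (1 - w)" if "y = - w * x" for x y w :: real
    by (simp add: that algebra_simps)
  have "(\<Sum>i\<le>Suc m. real (q_binomial q (Suc m) i) * ?c i)
      = (\<Sum>i\<le>m. real (q_binomial q m i) * (?c i + real q ^ (m - i) * ?c (Suc i)))"
    by (rule sum_q_binomial_Suc)
  also have "\<dots> = (\<Sum>i\<le>m. real (q_binomial q m i) * ?c i * (1 - z * real q ^ m))"
  proof (rule sum.cong)
    fix i assume "i \<in> {..m}"
    then have "?c i + real q ^ (m - i) * ?c (Suc i) = ?c i * (1 - z * real q ^ m)"
      by (intro alg step) simp
    then show "real (q_binomial q m i) * (?c i + real q ^ (m - i) * ?c (Suc i))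
        = real (q_binomial q m i) * ?c i * (1 - z * real q ^ m)"
      by (simp only: mult.assoc)
  qed simp
  finally show ?case
    using Suc by (simp add: sum_distrib_right[symmetric])
qed (simp add: numeral_2_eq_2)

section \<open>The inverse of the rank generating matrix\<close>

lemma int_choose_two: "2 * int (n choose 2) = int n * (int n - 1)"
  by (induction n) (simp_all add: numeral_2_eq_2 algebra_simps)

lemma choose_two_diff:
  assumes "j \<le> i"
  shows "int ((i - j) choose 2) = int (i choose 2) + int (j choose 2) + int j - int i * int j"
  using int_choose_two[of "i - j"] int_choose_two[of i] int_choose_two[of j] assms
  by (simp add: of_nat_diff algebra_simps)

text \<open>
  With \<open>T d = d (d - 1) / 2\<close> extended to negative \<open>d\<close> one has \<open>T (-d) = T d + d\<close>. Hence the last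
  factor of \<open>\<beta>\<^sub>q\<close>, which is defined through \<open>\<bar>i - j\<bar>\<close> and \<open>max i j\<close>, is given by the same
  three powers of \<open>q\<close> whether \<open>i \<ge> j\<close> or \<open>i < j\<close>; only the order of the first two changes.
\<close>

lemma beta_exponents:
  fixes Q :: real and i j :: nat
  assumes "Q \<noteq> 0"
  defines "e \<equiv> nat \<bar>int i - int j\<bar>" and "T \<equiv> \<lambda>k. int (k choose 2)"
  shows "Q ^ (e choose 2) * (1 + Q ^ e - Q ^ max i j) =
    Q powi (T i + T j - int i * int j + int j) + Q powi (T i + T j - int i * int j + int i)
     - Q powi (T i + T j - int i * int j + int i + int j)"
proof (cases "j \<le> i")
  case True
  then have e: "e = i - j" by (simp add: e_def)
  have T: "T e = T i + T j - int i * int j + int j"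
    using choose_two_diff[OF True] by (simp add: T_def e)
  have "Q ^ (e choose 2) = Q powi T e" "Q ^ e = Q powi (int i - int j)"
    "Q ^ max i j = Q powi int i"
    using True by (simp_all add: T_def e power_int_def nat_diff_distrib)
  then have "Q ^ (e choose 2) * (1 + Q ^ e - Q ^ max i j)
      = Q powi T e + Q powi (T e + (int i - int j)) - Q powi (T e + int i)"
    by (simp only: power_int_add[OF disjI1[OF assms(1)]] ring_distribs mult_1_right)
  also have "T e + (int i - int j) = T i + T j - int i * int j + int i"
    using T by simp
  also have "T e + int i = T i + T j - int i * int j + int i + int j"
    using T by simp
  finally show ?thesis by (simp only: T)
next
  case False
  then have e: "e = j - i" by (simp add: e_def)
  have T: "T e = T i + T j - int i * int j + int i"
    using choose_two_diff[of i j] False by (simp add: T_def e mult.commute)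
  have "Q ^ (e choose 2) = Q powi T e" "Q ^ e = Q powi (int j - int i)"
    "Q ^ max i j = Q powi int j"
    using False by (simp_all add: T_def e power_int_def nat_diff_distrib)
  then have "Q ^ (e choose 2) * (1 + Q ^ e - Q ^ max i j)
      = Q powi T e + Q powi (T e + (int j - int i)) - Q powi (T e + int j)"
    by (simp only: power_int_add[OF disjI1[OF assms(1)]] ring_distribs mult_1_right)
  also have "T e + (int j - int i) = T i + T j - int i * int j + int j"
    using T by simp
  also have "T e + int j = T i + T j - int i * int j + int i + int j"
    using T by simp
  finally show ?thesis by (simp only: T add.commute)
qed

lemma prod_eq_0_negative_power:
  fixes Q :: real
  assumes "Q \<noteq> 0" "k < m"
  shows "(\<Prod>i<m. 1 - Q powi (- int k) * Q ^ i) = 0"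
  using assms by (intro prod_zero) (auto intro!: bexI[of _ k] simp: power_int_minus)

text \<open>
  By \<open>beta_exponents\<close> the three terms of \<open>\<beta>\<^sub>q(i,j;0,0)\<close> contain \<open>i\<close> and \<open>j\<close> jointly only in the
  factor \<open>q\<^bsup>-ij\<^esup>\<close>, which cancels against \<open>q\<^bsup>(m-i)(n-j)\<^esup>\<close>. So each of the three double sums
  factors. Writing \<open>A m z\<close> for the product of the \<open>1 - z q\<^sup>k\<close> with \<open>k < m\<close>, the total is, up to
  \<open>q\<^bsup>mn\<^esup>\<close>,
  \<open>A m (q\<^bsup>-n\<^esup>) A n (q\<^bsup>1-m\<^esup>) + A m (q\<^bsup>1-n\<^esup>) A n (q\<^bsup>-m\<^esup>) - A m (q\<^bsup>1-n\<^esup>) A n (q\<^bsup>1-m\<^esup>)\<close>.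
  As \<open>A m (q\<^bsup>-k\<^esup>) = 0\<close> for \<open>0 \<le> k < m\<close>, every summand vanishes when \<open>m\<close> and \<open>n\<close> are both
  positive; if one of them is \<open>0\<close>, two summands cancel and the third is \<open>A k 1\<close> with \<open>k\<close>
  the other one, which is \<open>0\<close> for \<open>k > 0\<close> and \<open>1\<close> for \<open>k = 0\<close>.
\<close>

lemma beta_orthogonality_0:
  assumes "q > 0"
  shows "(\<Sum>i\<le>m. \<Sum>j\<le>n. int (q_binomial q m i * q_binomial q n j * q ^ ((m - i) * (n - j)))
            * beta_q q i j 0 0) = (if m = 0 \<and> n = 0 then 1 else 0)"
proof -
  define Q where "Q = real q"
  have Q: "Q \<noteq> 0" using assms by (simp add: Q_def)
  define A where "A m z = (\<Sum>i\<le>m. real (q_binomial q m i) * ((- 1) ^ i * Q ^ (i choose 2) * z ^ i))"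
    for m z
  have A: "A m z = (\<Prod>k<m. 1 - z * Q ^ k)" for m z
    unfolding A_def Q_def by (rule q_binomial_theorem)
  have A_0: "A m (Q powi (- int k)) = 0" if "k < m" for m k
    unfolding A using Q that by (rule prod_eq_0_negative_power)
  have A_1: "A m (Q powi (1 - int n)) = 0" if "0 < n" "n \<le> m" for m n
    using A_0[of "n - 1" m] that by (simp add: of_nat_diff)
  have AA: "A m (Q powi u) * A n (Q powi v) = (\<Sum>i\<le>m. \<Sum>j\<le>n.
      real (q_binomial q m i) * real (q_binomial q n j) * (- 1) ^ (i + j)
       * Q powi (int (i choose 2) + int (j choose 2) + u * int i + v * int j))" for u v
    unfolding A_def sum_product
    by (intro sum.cong refl) (simp add: power_int_add Q power_add power_int_mult mult_ac)
  have summand: "real_of_int (int (q_binomial q m i * q_binomial q n j * q ^ ((m - i) * (n - j)))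
            * beta_q q i j 0 0)
     = Q powi (int m * int n) *
        (real (q_binomial q m i) * real (q_binomial q n j) * (- 1) ^ (i + j)
       * Q powi (int (i choose 2) + int (j choose 2) + (- int n) * int i + (1 - int m) * int j)
       + real (q_binomial q m i) * real (q_binomial q n j) * (- 1) ^ (i + j)
       * Q powi (int (i choose 2) + int (j choose 2) + (1 - int n) * int i + (- int m) * int j)
       - real (q_binomial q m i) * real (q_binomial q n j) * (- 1) ^ (i + j)
       * Q powi (int (i choose 2) + int (j choose 2) + (1 - int n) * int i + (1 - int m) * int j))"
    if "i \<le> m" "j \<le> n" for i j
  proof -
    let ?e = "nat \<bar>int i - int j\<bar>"
    have distribute: "Q powi u * (Q powi x + Q powi y - Q powi z)
        = Q powi (u + x) + Q powi (u + y) - Q powi (u + z)" for u x y z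
      by (simp only: power_int_add[OF disjI1[OF Q]] ring_distribs)
    let ?E = "(int m - int i) * (int n - int j)"
      and ?T = "int (i choose 2) + int (j choose 2)"
    have exponents:
      "?E + (?T - int i * int j + int j)
        = int m * int n + (?T + (- int n) * int i + (1 - int m) * int j)"
      "?E + (?T - int i * int j + int i)
        = int m * int n + (?T + (1 - int n) * int i + (- int m) * int j)"
      "?E + (?T - int i * int j + int i + int j)
        = int m * int n + (?T + (1 - int n) * int i + (1 - int m) * int j)"
      by (simp_all add: algebra_simps)
    have q: "real q ^ ((m - i) * (n - j)) = Q powi ((int m - int i) * (int n - int j))"
      unfolding Q_def power_int_of_nat[symmetric] using that by (simp add: of_nat_diff)
    have "real_of_int (int (q_binomial q m i * q_binomial q n j * q ^ ((m - i) * (n - j)))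
            * beta_q q i j 0 0) = real (q_binomial q m i) * real (q_binomial q n j) * (- 1) ^ (i + j)
            * (real q ^ ((m - i) * (n - j)) * (Q ^ (?e choose 2) * (1 + Q ^ ?e - Q ^ max i j)))"
      by (simp add: beta_q_def Let_def Q_def)
    also have "\<dots> = real (q_binomial q m i) * real (q_binomial q n j) * (- 1) ^ (i + j) *
       (Q powi (int m * int n + (int (i choose 2) + int (j choose 2) + (- int n) * int i + (1 - int m) * int j))
       + Q powi (int m * int n + (int (i choose 2) + int (j choose 2) + (1 - int n) * int i + (- int m) * int j))
       - Q powi (int m * int n + (int (i choose 2) + int (j choose 2) + (1 - int n) * int i + (1 - int m) * int j)))"
      unfolding beta_exponents[OF Q] q distribute by (simp only: exponents)
    also have "\<dots> = Q powi (int m * int n) *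
        (real (q_binomial q m i) * real (q_binomial q n j) * (- 1) ^ (i + j)
       * Q powi (?T + (- int n) * int i + (1 - int m) * int j)
       + real (q_binomial q m i) * real (q_binomial q n j) * (- 1) ^ (i + j)
       * Q powi (?T + (1 - int n) * int i + (- int m) * int j)
       - real (q_binomial q m i) * real (q_binomial q n j) * (- 1) ^ (i + j)
       * Q powi (?T + (1 - int n) * int i + (1 - int m) * int j))"
      unfolding distribute[symmetric] by (simp only: ring_distribs mult_ac)
    finally show ?thesis .
  qed
  have "real_of_int (\<Sum>i\<le>m. \<Sum>j\<le>n.
      int (q_binomial q m i * q_binomial q n j * q ^ ((m - i) * (n - j))) * beta_q q i j 0 0)
     = Q powi (int m * int n) *
        (A m (Q powi (- int n)) * A n (Q powi (1 - int m))
       + A m (Q powi (1 - int n)) * A n (Q powi (- int m))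
       - A m (Q powi (1 - int n)) * A n (Q powi (1 - int m)))"
    unfolding AA of_int_sum sum.distrib[symmetric] sum_subtractf[symmetric] sum_distrib_left
    by (intro sum.cong refl summand) auto
  also have "\<dots> = (if m = 0 \<and> n = 0 then 1 else 0)"
  proof (cases "m = 0 \<or> n = 0")
    case True
    moreover have "A 0 z = 1" for z by (simp add: A)
    moreover have "A k 1 = 0" if "k > 0" for k using A_0[of 0 k] that by simp
    ultimately show ?thesis by auto
  next
    case False
    then consider "m < n" "0 < m" | "n < m" "0 < n" | "m = n" "0 < n" by linarith
    then show ?thesis
      using A_0[of n m] A_0[of m n] A_1[of n m] A_1[of m n] by cases auto
  qed
  finally show ?thesis
    by (metis (mono_tags, lifting) of_int_0 of_int_1 of_int_eq_iff)
qed

text \<open>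
  Since \<open>[s,i]\<^sub>q [i,c]\<^sub>q = [s,c]\<^sub>q [s-c,i-c]\<^sub>q\<close>, and the rest of \<open>\<beta>\<^sub>q(i,j;c,d)\<close> depends only on
  \<open>i - c\<close> and \<open>j - d\<close>, the general case is the case \<open>c = d = 0\<close> with \<open>s - c\<close> and \<open>t - d\<close> in
  place of \<open>s\<close> and \<open>t\<close>.
\<close>

lemma beta_orthogonality:
  assumes "q > 0"
  shows "(\<Sum>i\<le>s. \<Sum>j\<le>t. int (q_binomial q s i * q_binomial q t j * q ^ ((s - i) * (t - j)))
            * beta_q q i j c d) = (if c = s \<and> d = t then 1 else 0)"
proof (cases "c \<le> s \<and> d \<le> t")
  case False
  then show ?thesis by (auto simp: beta_q_def Let_def intro!: sum.neutral)
next
  case True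
  let ?g = "\<lambda>i j. int (q_binomial q s i * q_binomial q t j * q ^ ((s - i) * (t - j))) * beta_q q i j c d"
  have shift: "(\<Sum>i\<le>s. f i) = (\<Sum>i\<le>s - c. f (c + i))" if "c \<le> s" "\<And>i. i < c \<Longrightarrow> f i = 0"
    for f :: "nat \<Rightarrow> int" and c s
  proof -
    have "(\<Sum>i\<le>s. f i) = (\<Sum>i=c..s. f i)"
      using that by (intro sum.mono_neutral_right) auto
    also have "\<dots> = (\<Sum>i=0..s-c. f (c + i))"
      using that(1) sum.shift_bounds_cl_nat_ivl[of f 0 c "s - c"] by (simp add: add.commute)
    finally show ?thesis by (simp add: atMost_atLeast0)
  qed
  have "(\<Sum>i\<le>s. \<Sum>j\<le>t. ?g i j) = (\<Sum>i\<le>s - c. \<Sum>j\<le>t. ?g (c + i) j)"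
    by (rule shift) (use True in \<open>auto simp: beta_q_def Let_def\<close>)
  also have "\<dots> = (\<Sum>i\<le>s - c. \<Sum>j\<le>t - d. ?g (c + i) (d + j))"
    by (rule sum.cong[OF refl], rule shift) (use True in \<open>auto simp: beta_q_def Let_def\<close>)
  also have "\<dots> = int (q_binomial q s c * q_binomial q t d) * (\<Sum>i\<le>s - c. \<Sum>j\<le>t - d.
      int (q_binomial q (s - c) i * q_binomial q (t - d) j * q ^ ((s - c - i) * (t - d - j)))
            * beta_q q i j 0 0)"
    unfolding sum_distrib_left
  proof (intro sum.cong refl)
    fix i j assume ij: "i \<in> {..s - c}" "j \<in> {..t - d}"
    have beta: "beta_q q (c + i) (d + j) c d
        = int (q_binomial q (c + i) c) * int (q_binomial q (d + j) d) * beta_q q i j 0 0"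
      by (simp add: beta_q_def Let_def)
    have "c + i \<le> s" "d + j \<le> t" using ij True by auto
    then have trinomial:
      "q_binomial q s (c + i) * q_binomial q (c + i) c = q_binomial q s c * q_binomial q (s - c) i"
      "q_binomial q t (d + j) * q_binomial q (d + j) d = q_binomial q t d * q_binomial q (t - d) j"
      by (simp_all only: q_binomial_trinomial)
    have "?g (c + i) (d + j) = int (q_binomial q s (c + i) * q_binomial q (c + i) c)
       * int (q_binomial q t (d + j) * q_binomial q (d + j) d)
       * (int (q ^ ((s - (c + i)) * (t - (d + j)))) * beta_q q i j 0 0)"
      unfolding beta of_nat_mult by (simp only: mult_ac)
    also have "\<dots> = int (q_binomial q s c * q_binomial q t d) *
      (int (q_binomial q (s - c) i * q_binomial q (t - d) j * q ^ ((s - c - i) * (t - d - j)))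
            * beta_q q i j 0 0)"
      unfolding trinomial of_nat_mult diff_diff_add by (simp only: mult_ac)
    finally show "?g (c + i) (d + j) = int (q_binomial q s c * q_binomial q t d) *
      (int (q_binomial q (s - c) i * q_binomial q (t - d) j * q ^ ((s - c - i) * (t - d - j)))
            * beta_q q i j 0 0)" .
  qed
  also have "\<dots> = (if c = s \<and> d = t then 1 else 0)"
    using True unfolding beta_orthogonality_0[OF assms] by auto
  finally show ?thesis .
qed

section \<open>The action of \<open>\<beta>\<^sub>q\<close> on polynomials\<close>

lemma coeff_sum_xy: "coeff (coeff (\<Sum>x\<in>A. f x) i) j = (\<Sum>x\<in>A. coeff (coeff (f x) i) j)"
  by (simp add: coeff_sum)

lemma coeff_of_int_mult_xy:
  "coeff (coeff (of_int c * (p :: int poly poly)) i) j = c * coeff (coeff p i) j"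
  by (simp add: of_int_poly)

lemma coeff_of_nat_mult_xy:
  "coeff (coeff (of_nat n * (p :: int poly poly)) i) j = int n * coeff (coeff p i) j"
  using coeff_of_int_mult_xy[of "int n"] by simp

text \<open>
  The definition of \<^const>\<open>beta_act\<close> sums up to the degrees of its argument. Bounds that can be
  shared by several polynomials are what makes additivity visible.
\<close>

lemma coeff_beta_act:
  assumes N: "degree p \<le> N" and M: "\<And>i. degree (coeff p i) \<le> M"
  shows "coeff (coeff (beta_act q p) c) d
       = (\<Sum>i\<le>N. \<Sum>j\<le>M. coeff (coeff p i) j * beta_q q i j c d)"
proof -
  have beta: "(\<Sum>a\<le>i. \<Sum>b\<le>j. if c = a \<and> d = b then beta_q q i j a b else 0) = beta_q q i j c d"
    for i j
  proof -
    have "(\<Sum>a\<le>i. \<Sum>b\<le>j. if c = a \<and> d = b then beta_q q i j a b else 0)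
        = (\<Sum>a\<le>i. if c = a then \<Sum>b\<le>j. if d = b then beta_q q i j a b else 0 else 0)"
      by (intro sum.cong refl) simp
    also have "\<dots> = beta_q q i j c d"
      by (simp add: sum.delta) (auto simp: beta_q_def Let_def)
    finally show ?thesis .
  qed
  have "coeff (coeff (beta_act q p) c) d
      = (\<Sum>i\<le>degree p. \<Sum>j\<le>degree (coeff p i). coeff (coeff p i) j * beta_q q i j c d)"
    unfolding beta_act_def coeff_sum_xy coeff_of_int_mult_xy coeff_monomial_xy beta ..
  also have "\<dots> = (\<Sum>i\<le>degree p. \<Sum>j\<le>M. coeff (coeff p i) j * beta_q q i j c d)"
    using M by (intro sum.cong refl sum.mono_neutral_left) (auto simp: coeff_eq_0)
  also have "\<dots> = (\<Sum>i\<le>N. \<Sum>j\<le>M. coeff (coeff p i) j * beta_q q i j c d)"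
    using N by (intro sum.mono_neutral_left) (auto simp: coeff_eq_0 not_le)
  finally show ?thesis .
qed

lemma degree_coeff_bounded: "\<exists>M. \<forall>i. degree (coeff (p :: 'r::zero poly poly) i) \<le> M"
proof -
  have "degree (coeff p i) \<le> Max ((\<lambda>i. degree (coeff p i)) ` {..degree p})" for i
    by (cases "i \<le> degree p") (auto simp: coeff_eq_0)
  then show ?thesis by blast
qed

lemma beta_act_add: "beta_act q (p + p') = beta_act q p + beta_act q p'"
proof -
  obtain M M' where M: "\<And>i. degree (coeff p i) \<le> M" "\<And>i. degree (coeff p' i) \<le> M'"
    using degree_coeff_bounded by metis
  let ?N = "max (degree p) (degree p')" and ?M = "max M M'"
  have *: "degree (coeff p i) \<le> ?M" "degree (coeff p' i) \<le> ?M" for i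
    using M by (meson max.coboundedI1 max.coboundedI2)+
  then have **: "degree (coeff (p + p') i) \<le> ?M" for i
    unfolding coeff_add by (rule degree_add_le)
  show ?thesis
    unfolding poly_eq_iff
    by (auto simp: coeff_beta_act[where N = ?N and M = ?M] * ** degree_add_le sum.distrib distrib_right)
qed

lemma beta_act_sum: "beta_act q (\<Sum>x\<in>A. f x) = (\<Sum>x\<in>A. beta_act q (f x))"
proof (induction A rule: infinite_finite_induct)
  case (insert x A)
  then show ?case by (simp add: beta_act_add)
qed (simp_all add: beta_act_def)

lemma coeff_beta_act_monomial:
  "coeff (coeff (beta_act q (var_x ^ i * var_y ^ j)) c) d = beta_q q i j c d"
proof -
  let ?p = "var_x ^ i * var_y ^ j"
  have coeff: "coeff (coeff ?p k) l = (if k = i \<and> l = j then 1 else 0)" for k l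
    using coeff_monomial_xy[of 1 i j k l] by simp
  have "degree ?p \<le> i" "\<And>k. degree (coeff ?p k) \<le> j"
    by (auto intro!: degree_le poly_eqI simp: coeff)
  then have "coeff (coeff (beta_act q ?p) c) d
      = (\<Sum>k\<le>i. \<Sum>l\<le>j. coeff (coeff ?p k) l * beta_q q k l c d)"
    by (rule coeff_beta_act)
  also have "\<dots> = (\<Sum>k\<le>i. \<Sum>l\<le>j. if l = j then if k = i then beta_q q k l c d else 0 else 0)"
    unfolding coeff by (intro sum.cong refl) auto
  finally show ?thesis by simp
qed

text \<open>
  The sum on the left is \<open>\<beta>\<^sub>q\<close> applied to the rank generating polynomial of a prime-free
  matroid or \<open>q\<close>-matroid of rank \<open>s\<close> and nullity \<open>t\<close>; here \<open>i\<close> is the rank of an element, so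
  that its exponent of \<open>x\<close> is the corank \<open>s - i\<close>.
\<close>

lemma beta_act_inverts_rank_gen:
  assumes "q > 0"
  shows "(\<Sum>i\<le>s. \<Sum>j\<le>t. of_nat (q_binomial q s i * q_binomial q t j * q ^ (i * (t - j)))
            * beta_act q (var_x ^ (s - i) * var_y ^ j)) = var_x ^ s * var_y ^ t"
proof -
  have rev: "(\<Sum>i\<le>s. g (s - i)) = (\<Sum>i\<le>s. g i)" for g :: "nat \<Rightarrow> int"
    using sum.nat_diff_reindex[of g "Suc s"] by (simp add: lessThan_Suc_atMost)
  have "coeff (coeff (\<Sum>i\<le>s. \<Sum>j\<le>t. of_nat (q_binomial q s i * q_binomial q t j * q ^ (i * (t - j)))
            * beta_act q (var_x ^ (s - i) * var_y ^ j)) c) d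
      = coeff (coeff (var_x ^ s * var_y ^ t) c) d" (is "?lhs = ?rhs") for c d
  proof -
    have "?lhs = (\<Sum>i\<le>s. \<Sum>j\<le>t. int (q_binomial q s i * q_binomial q t j * q ^ (i * (t - j)))
            * beta_q q (s - i) j c d)"
      unfolding coeff_sum_xy coeff_of_nat_mult_xy coeff_beta_act_monomial ..
    also have "\<dots> = (\<Sum>i\<le>s. \<Sum>j\<le>t.
        int (q_binomial q s (s - i) * q_binomial q t j * q ^ ((s - (s - i)) * (t - j)))
          * beta_q q (s - i) j c d)"
      by (intro sum.cong refl) (simp add: q_binomial_symmetric)
    also have "\<dots> = (\<Sum>i\<le>s. \<Sum>j\<le>t.
        int (q_binomial q s i * q_binomial q t j * q ^ ((s - i) * (t - j))) * beta_q q i j c d)"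
      by (rule rev)
    also have "\<dots> = ?rhs"
      unfolding beta_orthogonality[OF assms] using coeff_monomial_xy[of 1 s t c d] by auto
    finally show ?thesis .
  qed
  then show ?thesis by (simp add: poly_eq_iff)
qed


section \<open>Lattices with Gaussian cover numbers\<close>

text \<open>
  The common properties of the Boolean lattice (\<open>q = 1\<close>) and of the lattice of subspaces over a
  field with \<open>q\<close> elements. The number of covers also yields relative complements and elements of
  every intermediate height.
\<close>

locale q_lattice =
  fixes L :: "'a set set" and join :: "'a set \<Rightarrow> 'a set \<Rightarrow> 'a set"
    and h :: "'a set \<Rightarrow> nat" and q :: nat
  assumes q_pos: "q > 0"
    and finite_L: "finite L"
    and Int_closed: "x \<in> L \<Longrightarrow> y \<in> L \<Longrightarrow> x \<inter> y \<in> L"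
    and join_closed: "x \<in> L \<Longrightarrow> y \<in> L \<Longrightarrow> join x y \<in> L"
    and join_upper: "x \<in> L \<Longrightarrow> y \<in> L \<Longrightarrow> x \<union> y \<subseteq> join x y"
    and join_least: "x \<in> L \<Longrightarrow> y \<in> L \<Longrightarrow> z \<in> L \<Longrightarrow> x \<subseteq> z \<Longrightarrow> y \<subseteq> z \<Longrightarrow> join x y \<subseteq> z"
    and modular: "x \<in> L \<Longrightarrow> y \<in> L \<Longrightarrow> h (join x y) + h (x \<inter> y) = h x + h y"
    and h_strict_mono: "x \<in> L \<Longrightarrow> y \<in> L \<Longrightarrow> x \<subset> y \<Longrightarrow> h x < h y"
    and card_covers: "x \<in> L \<Longrightarrow> y \<in> L \<Longrightarrow> x \<subseteq> y \<Longrightarrow>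
          card {z \<in> L. x \<subseteq> z \<and> z \<subseteq> y \<and> h z = Suc (h x)} = q_int q (h y - h x)"
begin

abbreviation covers :: "'a set \<Rightarrow> 'a set \<Rightarrow> 'a set set" where
  "covers x y \<equiv> {z \<in> L. x \<subseteq> z \<and> z \<subseteq> y \<and> h z = Suc (h x)}"

lemma h_mono: "x \<in> L \<Longrightarrow> y \<in> L \<Longrightarrow> x \<subseteq> y \<Longrightarrow> h x \<le> h y"
  using h_strict_mono[of x y] by (cases "x = y") (auto simp: psubset_eq)

lemma eq_if_h_ge: "x \<in> L \<Longrightarrow> y \<in> L \<Longrightarrow> x \<subseteq> y \<Longrightarrow> h y \<le> h x \<Longrightarrow> x = y"
  using h_strict_mono[of x y] by (cases "x = y") (auto simp: psubset_eq)

lemma interval_subset: "interval L a b \<subseteq> L"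
  by (auto simp: interval_def)

lemma finite_interval [simp]: "finite (interval L a b)"
  using finite_subset[OF interval_subset finite_L] .

text \<open>
  The interval \<open>[x, y]\<close> has more atoms than its proper part \<open>[x, c]\<close>, so some atom is not below
  \<open>c\<close>.
\<close>

lemma cover_avoiding:
  assumes "x \<in> L" "c \<in> L" "y \<in> L" "x \<subseteq> c" "c \<subset> y"
  obtains z where "z \<in> covers x y" "\<not> z \<subseteq> c"
proof -
  have "h x \<le> h c" "h c < h y"
    using assms h_mono h_strict_mono by auto
  then have "q_int q (h y - h x) = q_int q (h c - h x) + q ^ (h c - h x) * q_int q (h y - h c)"
    using q_int_add[of q "h c - h x" "h y - h c"] by simp
  moreover have "q ^ (h c - h x) * q_int q (h y - h c) > 0"
    using q_pos \<open>h c < h y\<close> by (simp add: q_int_pos)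
  ultimately have "card (covers x c) < card (covers x y)"
    using assms by (simp add: card_covers)
  moreover have "finite (covers x c)"
    using finite_L by simp
  ultimately have "\<not> covers x y \<subseteq> covers x c"
    by (meson card_mono leD)
  then show thesis using that by auto
qed

lemma element_of_max_height:
  assumes "finite S" "x \<in> S"
  obtains z where "z \<in> S" "\<And>w. w \<in> S \<Longrightarrow> h w \<le> h z"
proof -
  have "Max (h ` S) \<in> h ` S" using assms by (intro Max_in) auto
  then obtain z where "z \<in> S" "h z = Max (h ` S)" by auto
  then show thesis using that assms by simp
qed

lemma element_of_height:
  assumes "x \<in> L" "y \<in> L" "x \<subseteq> y" "h x \<le> k" "k \<le> h y"
  obtains z where "z \<in> L" "x \<subseteq> z" "z \<subseteq> y" "h z = k"
  using assms(4,5)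
proof (induction k arbitrary: thesis rule: dec_induct)
  case base
  then show ?case using assms by blast
next
  case (step k)
  then obtain z where z: "z \<in> L" "x \<subseteq> z" "z \<subseteq> y" "h z = k" by auto
  then have "z \<subset> y" using step by auto
  then obtain w where "w \<in> covers z y"
    using cover_avoiding[OF z(1) z(1) assms(2) order_refl] by metis
  then show ?case using step.prems z by auto
qed

text \<open>
  A complement of \<open>z\<close> is an element \<open>w\<close> of greatest height among those that meet \<open>z\<close> in \<open>x\<close>:
  if \<open>join z w\<close> were not \<open>y\<close>, a cover of \<open>w\<close> that is not below \<open>join z w\<close> would still meet
  \<open>z\<close> in \<open>x\<close>.
\<close>

lemma relative_complement:
  assumes "x \<in> L" "y \<in> L" "z \<in> L" "x \<subseteq> z" "z \<subseteq> y"
  obtains w where "w \<in> L" "x \<subseteq> w" "w \<subseteq> y" "z \<inter> w = x" "join z w = y"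
proof -
  let ?S = "{w \<in> L. x \<subseteq> w \<and> w \<subseteq> y \<and> z \<inter> w = x}"
  have "finite ?S" "x \<in> ?S" using finite_L assms by auto
  then obtain w where w: "w \<in> ?S" and max: "\<And>w'. w' \<in> ?S \<Longrightarrow> h w' \<le> h w"
    by (rule element_of_max_height) blast
  let ?j = "join z w"
  have j: "?j \<in> L" "z \<subseteq> ?j" "w \<subseteq> ?j" "?j \<subseteq> y"
    using w assms join_closed join_upper[of z w] join_least[of z w y] by auto
  have "?j = y"
  proof (rule ccontr)
    assume "?j \<noteq> y"
    then obtain v where v: "v \<in> covers w y" "\<not> v \<subseteq> ?j"
      using cover_avoiding[of w ?j y] w j assms by blast
    have vj: "v \<inter> ?j \<in> L" using v j Int_closed by auto
    have "h (v \<inter> ?j) < h v" using v vj by (intro h_strict_mono) auto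
    then have "w = v \<inter> ?j"
      using v w j vj by (intro eq_if_h_ge) auto
    then have "v \<in> ?S" using v w j by auto
    with max v show False by fastforce
  qed
  then show thesis using that w by auto
qed

lemma height_meet_coatom:
  assumes "z \<in> L" "H \<in> L" "b \<in> L" "z \<subseteq> b" "H \<subseteq> b" "h b = Suc (h H)" "\<not> z \<subseteq> H"
  shows "h z = Suc (h (z \<inter> H))"
proof -
  have "H \<subset> join z H" "join z H \<subseteq> b" "join z H \<in> L"
    using assms join_upper[of z H] join_least[of z H b] join_closed[of z H] by auto
  then have "h (join z H) = h b"
    using h_strict_mono[of H "join z H"] h_mono[of "join z H" b] assms by simp
  then show ?thesis using modular[of z H] assms by simp
qed

text \<open>
  The elements \<open>z\<close> of \<open>[a, b]\<close> not below the coatom \<open>H\<close> are grouped by \<open>w = z \<inter> H\<close>. They cover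
  \<open>w\<close>, so with \<open>n = h H - h w\<close> there are \<open>(1 + \<dots> + q\<^sup>n) - (1 + \<dots> + q\<^bsup>n-1\<^esup>) = q\<^sup>n\<close> of them
  for each \<open>w\<close>.
\<close>

lemma sum_interval_coatom:
  fixes f g :: "'a set \<Rightarrow> 'r::comm_semiring_1"
  assumes L: "a \<in> L" "b \<in> L" "H \<in> L" "a \<subseteq> H" "H \<subseteq> b" and hb: "h b = Suc (h H)"
    and g: "\<And>z. z \<in> interval L a b \<Longrightarrow> \<not> z \<subseteq> H \<Longrightarrow> g z = f (z \<inter> H)"
  shows "(\<Sum>z\<in>interval L a b. g z)
       = (\<Sum>w\<in>interval L a H. g w + of_nat (q ^ (h H - h w)) * f w)"
proof -
  let ?N = "{z \<in> interval L a b. \<not> z \<subseteq> H}"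
  have split: "interval L a b = interval L a H \<union> ?N" "interval L a H \<inter> ?N = {}"
    using L by (auto simp: interval_def)
  have meet: "z \<inter> H \<in> interval L a H" "h z = Suc (h (z \<inter> H))" if "z \<in> ?N" for z
  proof -
    have z: "z \<in> L" "a \<subseteq> z" "z \<subseteq> b" "\<not> z \<subseteq> H" using that by (auto simp: interval_def)
    show "z \<inter> H \<in> interval L a H" using z L Int_closed by (auto simp: interval_def)
    show "h z = Suc (h (z \<inter> H))"
      using z L hb by (intro height_meet_coatom)
  qed
  have fibre: "{z \<in> ?N. z \<inter> H = w} = covers w b - covers w H" if "w \<in> interval L a H" for w
  proof (intro equalityI subsetI)
    fix z assume "z \<in> {z \<in> ?N. z \<inter> H = w}"
    then show "z \<in> covers w b - covers w H"
      using meet[of z] by (auto simp: interval_def)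
  next
    fix z assume z: "z \<in> covers w b - covers w H"
    have w: "w \<in> L" "a \<subseteq> w" "w \<subseteq> H" using that by (auto simp: interval_def)
    have zN: "z \<in> ?N" using z w by (auto simp: interval_def)
    have "w = z \<inter> H"
      using z w meet[OF zN] L Int_closed by (intro eq_if_h_ge) auto
    then show "z \<in> {z \<in> ?N. z \<inter> H = w}" using zN by simp
  qed
  have card: "card {z \<in> ?N. z \<inter> H = w} = q ^ (h H - h w)" if "w \<in> interval L a H" for w
  proof -
    have w: "w \<in> L" "w \<subseteq> H" using that by (auto simp: interval_def)
    then have hw: "h w \<le> h H" using h_mono L by blast
    have "card (covers w b - covers w H) = card (covers w b) - card (covers w H)"
      using L finite_L by (intro card_Diff_subset) auto
    also have "\<dots> = q_int q (Suc (h H - h w)) - q_int q (h H - h w)"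
      using w L hw hb card_covers[of w b] card_covers[of w H] by (simp add: Suc_diff_le)
    finally show ?thesis unfolding fibre[OF that] by (simp add: q_int_def)
  qed
  have "(\<Sum>z\<in>?N. g z) = (\<Sum>w\<in>interval L a H. \<Sum>z\<in>{z \<in> ?N. z \<inter> H = w}. g z)"
    using meet(1) by (intro sum.group[symmetric]) auto
  also have "\<dots> = (\<Sum>w\<in>interval L a H. of_nat (q ^ (h H - h w)) * f w)"
  proof (intro sum.cong refl)
    fix w assume w: "w \<in> interval L a H"
    have "(\<Sum>z\<in>{z \<in> ?N. z \<inter> H = w}. g z) = (\<Sum>z\<in>{z \<in> ?N. z \<inter> H = w}. f w)"
      using g by (intro sum.cong) auto
    then show "(\<Sum>z\<in>{z \<in> ?N. z \<inter> H = w}. g z) = of_nat (q ^ (h H - h w)) * f w"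
      using card[OF w] by simp
  qed
  finally have N: "(\<Sum>z\<in>?N. g z) = (\<Sum>w\<in>interval L a H. of_nat (q ^ (h H - h w)) * f w)" .
  have "(\<Sum>z\<in>interval L a b. g z) = (\<Sum>z\<in>interval L a H. g z) + (\<Sum>z\<in>?N. g z)"
    by (subst split(1), rule sum.union_disjoint) (use split in auto)
  then show ?thesis by (simp add: N sum.distrib)
qed

lemma sum_interval_heights:
  fixes \<phi> :: "nat \<Rightarrow> 'r::comm_semiring_1"
  assumes "a \<in> L" "b \<in> L" "a \<subseteq> b"
  shows "(\<Sum>z\<in>interval L a b. \<phi> (h z - h a))
       = (\<Sum>j\<le>h b - h a. of_nat (q_binomial q (h b - h a) j) * \<phi> j)"
  using assms(2,3)
proof (induction "h b - h a" arbitrary: b \<phi>)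
  case 0
  then have "b = a" using eq_if_h_ge[of a b] assms(1) by auto
  then have "interval L a b = {a}" using assms(1) by (auto simp: interval_def)
  then show ?case using \<open>b = a\<close> by simp
next
  case (Suc n)
  then have hb: "h b = Suc (h a + n)" by simp
  obtain H where H: "H \<in> L" "a \<subseteq> H" "H \<subseteq> b" "h H = h a + n"
    using element_of_height[of a b "h a + n"] assms(1) Suc.prems hb by auto
  have *: "\<phi> (h z - h a) = \<phi> (Suc (h (z \<inter> H) - h a))" if "z \<in> interval L a b" "\<not> z \<subseteq> H" for z
  proof -
    have z: "z \<in> L" "a \<subseteq> z" "z \<subseteq> b" using that by (auto simp: interval_def)
    have zH: "z \<inter> H \<in> L" "h a \<le> h (z \<inter> H)"
      using z H Int_closed h_mono[of a "z \<inter> H"] assms(1) by auto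
    have "h z = Suc (h (z \<inter> H))"
      using z H Suc.prems hb that by (intro height_meet_coatom[of z H b]) auto
    then show ?thesis using zH by (simp add: Suc_diff_le)
  qed
  have "(\<Sum>z\<in>interval L a b. \<phi> (h z - h a))
      = (\<Sum>w\<in>interval L a H. \<phi> (h w - h a) + of_nat (q ^ (h H - h w)) * \<phi> (Suc (h w - h a)))"
    using H Suc.prems assms(1) hb by (intro sum_interval_coatom *) auto
  also have "\<dots> = (\<Sum>w\<in>interval L a H. (\<lambda>j. \<phi> j + of_nat (q ^ (n - j)) * \<phi> (Suc j)) (h w - h a))"
  proof (intro sum.cong refl)
    fix w assume "w \<in> interval L a H"
    then have "h a \<le> h w" using h_mono[OF assms(1)] by (auto simp: interval_def)
    then have "h H - h w = n - (h w - h a)" using H by simp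
    then show "\<phi> (h w - h a) + of_nat (q ^ (h H - h w)) * \<phi> (Suc (h w - h a))
        = \<phi> (h w - h a) + of_nat (q ^ (n - (h w - h a))) * \<phi> (Suc (h w - h a))"
      by simp
  qed
  also have "\<dots> = (\<Sum>j\<le>h H - h a. of_nat (q_binomial q (h H - h a) j)
                     * (\<phi> j + of_nat (q ^ (n - j)) * \<phi> (Suc j)))"
    using H by (intro Suc.hyps(1)) auto
  also have "\<dots> = (\<Sum>j\<le>Suc n. of_nat (q_binomial q (Suc n) j) * \<phi> j)"
    unfolding sum_q_binomial_Suc using H by simp
  finally show ?case using Suc.hyps(2) by simp
qed

text \<open>
  Equivalently, \<open>[s,i]\<^sub>q [t,j]\<^sub>q q\<^bsup>i(t-j)\<^esup>\<close> elements \<open>z\<close> of the interval have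
  \<open>h z - h (z \<inter> l) = i\<close> and \<open>h (z \<inter> l) - h a = j\<close>. The form with an arbitrary \<open>\<phi>\<close> suits an
  induction on \<open>s = h b - h l\<close>: for a coatom \<open>H\<close> of \<open>[a, b]\<close> above \<open>l\<close>, replacing \<open>z\<close> by
  \<open>z \<inter> H\<close> does not change \<open>z \<inter> l\<close>, so that splitting at \<open>H\<close> replaces \<open>\<phi>\<close> by another function
  of the same two heights.
\<close>

lemma sum_interval_meet_heights:
  fixes \<phi> :: "nat \<Rightarrow> nat \<Rightarrow> 'r::comm_semiring_1"
  assumes "a \<in> L" "l \<in> L" "b \<in> L" "a \<subseteq> l" "l \<subseteq> b"
  shows "(\<Sum>z\<in>interval L a b. \<phi> (h z - h (z \<inter> l)) (h (z \<inter> l) - h a))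
       = (\<Sum>i\<le>h b - h l. \<Sum>j\<le>h l - h a.
            of_nat (q_binomial q (h b - h l) i * q_binomial q (h l - h a) j
                     * q ^ (i * (h l - h a - j))) * \<phi> i j)"
  using assms(3,5)
proof (induction "h b - h l" arbitrary: b \<phi>)
  case 0
  then have b: "b = l" using eq_if_h_ge[of l b] assms(2) by auto
  have "(\<Sum>z\<in>interval L a l. \<phi> (h z - h (z \<inter> l)) (h (z \<inter> l) - h a))
      = (\<Sum>z\<in>interval L a l. \<phi> 0 (h z - h a))"
    by (intro sum.cong refl) (auto simp: interval_def Int_absorb2)
  also have "\<dots> = (\<Sum>j\<le>h l - h a. of_nat (q_binomial q (h l - h a) j) * \<phi> 0 j)"
    using assms by (intro sum_interval_heights)
  finally show ?case by (simp add: b)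
next
  case (Suc n)
  define t where "t = h l - h a"
  have t: "h l = h a + t" using h_mono[of a l] assms by (simp add: t_def)
  have hb: "h b = Suc (h l + n)" using Suc by simp
  obtain H where H: "H \<in> L" "l \<subseteq> H" "H \<subseteq> b" "h H = h l + n"
    using element_of_height[of l b "h l + n"] assms(2) Suc.prems hb by auto
  let ?r = "\<lambda>z. h z - h (z \<inter> l)" and ?n = "\<lambda>z. h (z \<inter> l) - h a"
  have *: "\<phi> (?r z) (?n z) = \<phi> (Suc (?r (z \<inter> H))) (?n (z \<inter> H))"
    if "z \<in> interval L a b" "\<not> z \<subseteq> H" for z
  proof -
    have z: "z \<in> L" "a \<subseteq> z" "z \<subseteq> b" using that by (auto simp: interval_def)
    have zl: "z \<inter> H \<inter> l = z \<inter> l" using H by auto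
    have zH: "h (z \<inter> l) \<le> h (z \<inter> H)"
      using z H assms by (intro h_mono Int_closed) auto
    have "h z = Suc (h (z \<inter> H))"
      using z H Suc.prems hb that by (intro height_meet_coatom[of z H b]) auto
    then show ?thesis using zH zl by (simp add: Suc_diff_le)
  qed
  let ?\<psi> = "\<lambda>i j. \<phi> i j + of_nat (q ^ (n - i + (t - j))) * \<phi> (Suc i) j"
  have "(\<Sum>z\<in>interval L a b. \<phi> (?r z) (?n z))
      = (\<Sum>w\<in>interval L a H. \<phi> (?r w) (?n w) + of_nat (q ^ (h H - h w)) * \<phi> (Suc (?r w)) (?n w))"
    using H Suc.prems assms hb by (intro sum_interval_coatom *) auto
  also have "\<dots> = (\<Sum>w\<in>interval L a H. ?\<psi> (?r w) (?n w))"
  proof (intro sum.cong refl)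
    fix w assume "w \<in> interval L a H"
    then have w: "w \<in> L" "a \<subseteq> w" "w \<subseteq> H" by (auto simp: interval_def)
    have wl: "w \<inter> l \<in> L" "join w l \<in> L" using w assms Int_closed join_closed by auto
    have "join w l \<subseteq> H" using w assms H by (intro join_least)
    then have "h (w \<inter> l) \<le> h w" "h a \<le> h (w \<inter> l)" "h (w \<inter> l) \<le> h l" "h (join w l) \<le> h H"
      using w wl assms H(1) by (auto intro!: h_mono)
    then have "h H - h w = n - ?r w + (t - ?n w)"
      using modular[of w l] w assms t H by simp
    then show "\<phi> (?r w) (?n w) + of_nat (q ^ (h H - h w)) * \<phi> (Suc (?r w)) (?n w) = ?\<psi> (?r w) (?n w)"
      by simp
  qed
  also have "\<dots> = (\<Sum>i\<le>n. \<Sum>j\<le>t. of_nat (q_binomial q n i * q_binomial q t j * q ^ (i * (t - j))) * ?\<psi> i j)"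
    using Suc.hyps(1)[of H ?\<psi>] H by (simp add: t_def)
  also have "\<dots> = (\<Sum>i\<le>n. of_nat (q_binomial q n i) *
      ((\<Sum>j\<le>t. of_nat (q_binomial q t j * q ^ (i * (t - j))) * \<phi> i j) + of_nat q ^ (n - i) *
       (\<Sum>j\<le>t. of_nat (q_binomial q t j * q ^ (Suc i * (t - j))) * \<phi> (Suc i) j)))"
  proof (intro sum.cong refl)
    fix i assume "i \<in> {..n}"
    have "q ^ (n - i) * q ^ (Suc i * (t - j)) = q ^ (i * (t - j)) * q ^ (n - i + (t - j))" for j
      by (simp add: power_add)
    then have "of_nat q ^ (n - i) * (of_nat q ^ (Suc i * (t - j)) * x)
        = of_nat q ^ (i * (t - j)) * (of_nat q ^ (n - i + (t - j)) * x)" for j and x :: 'r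
      unfolding mult.assoc[symmetric] of_nat_power[symmetric] of_nat_mult[symmetric] by simp
    then show "(\<Sum>j\<le>t. of_nat (q_binomial q n i * q_binomial q t j * q ^ (i * (t - j))) * ?\<psi> i j)
      = of_nat (q_binomial q n i) *
      ((\<Sum>j\<le>t. of_nat (q_binomial q t j * q ^ (i * (t - j))) * \<phi> i j) + of_nat q ^ (n - i) *
       (\<Sum>j\<le>t. of_nat (q_binomial q t j * q ^ (Suc i * (t - j))) * \<phi> (Suc i) j))"
      unfolding sum_distrib_left sum.distrib[symmetric]
      by (intro sum.cong refl)
        (simp only: of_nat_mult of_nat_power distrib_left mult.assoc mult.left_commute)
  qed
  also have "\<dots> = (\<Sum>i\<le>Suc n. of_nat (q_binomial q (Suc n) i) *
       (\<Sum>j\<le>t. of_nat (q_binomial q t j * q ^ (i * (t - j))) * \<phi> i j))"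
    by (rule sum_q_binomial_Suc[symmetric])
  also have "\<dots> = (\<Sum>i\<le>Suc n. \<Sum>j\<le>t. 
      of_nat (q_binomial q (Suc n) i * q_binomial q t j * q ^ (i * (t - j))) * \<phi> i j)"
    by (simp add: sum_distrib_left mult.assoc del: sum.atMost_Suc)
  finally show ?case unfolding Suc.hyps(2)[symmetric] t_def .
qed

section \<open>Prime-free intervals\<close>

text \<open>
  An element \<open>w\<close> of least height that violates the claim is a circuit above \<open>a\<close>: it is dependent,
  but everything properly below it is independent. If it covers \<open>a\<close>, it is a loop and hence below
  \<open>l\<close>. Otherwise there is an element \<open>c\<close> of height \<open>h w - 2\<close> in \<open>[a, w]\<close>, and the diamond
  \<open>[c, w]\<close> is prime, because the independent coatoms of \<open>w\<close> already have the rank of \<open>w\<close>.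
\<close>

lemma independent_in_prime_free:
  assumes rk: "rank_function L join h r"
    and L: "a \<in> L" "l \<in> L" "b \<in> L" "a \<subseteq> l" "l \<subseteq> b"
    and a: "r a = h a" and free: "prime_free L h r a b"
    and loops: "\<And>z. z \<in> interval L a b \<Longrightarrow> r z = r a \<Longrightarrow> z \<subseteq> l"
    and w: "w \<in> L" "a \<subseteq> w" "w \<subseteq> b" "w \<inter> l = a"
  shows "r w = h w"
  using w
proof (induction "h w" arbitrary: w rule: less_induct)
  case less
  have r_le: "r x \<le> h x" if "x \<in> L" for x using rk that by (auto simp: rank_function_def)
  have r_mono: "r x \<le> r y" if "x \<in> L" "y \<in> L" "x \<subseteq> y" for x y
    using rk that by (auto simp: rank_function_def)
  have below: "r x = h x" if "x \<in> L" "a \<subseteq> x" "x \<subset> w" for x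
    using that less h_strict_mono[of x w] L by (intro less.hyps) auto
  show ?case
  proof (rule ccontr)
    assume "r w \<noteq> h w"
    then have rw: "r w < h w" using r_le[of w] less.prems by simp
    have "w \<noteq> a" using rw a by auto
    then have "h a < h w" using less.prems L by (intro h_strict_mono) auto
    moreover have "h w \<noteq> Suc (h a)"
    proof
      assume "h w = Suc (h a)"
      then have "r w = r a" using rw a r_mono[of a w] less.prems L by simp
      then have "w \<subseteq> l" using less.prems by (intro loops) (auto simp: interval_def)
      then show False using \<open>w \<noteq> a\<close> less.prems by auto
    qed
    ultimately have "h a \<le> h w - 2" by simp
    then obtain c where c: "c \<in> L" "a \<subseteq> c" "c \<subseteq> w" "h c = h w - 2"
      using element_of_height[of a w "h w - 2"] L less.prems by auto
    have hw: "h w = h c + 2" using c \<open>h a \<le> h w - 2\<close> \<open>h a < h w\<close> \<open>h w \<noteq> Suc (h a)\<close> by simp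
    have "prime_diamond L h r c w"
      unfolding prime_diamond_def
    proof (intro conjI ballI impI)
      fix x assume x: "x \<in> L" "c \<subset> x \<and> x \<subset> w"
      have "h c < h x" "h x < h w"
        using x c less.prems h_strict_mono[of c x] h_strict_mono[of x w] by simp_all
      then have hx: "h x = h c + 1" using hw by simp
      have "r x = h x" "r c = h c" using x c below[of x] below[of c] by blast+
      then show "r x = r c + 1" using \<open>r x = h x\<close> \<open>r c = h c\<close> hx by simp
      show "r w = r x" using rw hx hw \<open>r x = h x\<close> r_mono[of x w] x less.prems by auto
    qed (use c less.prems hw in auto)
    then show False using free c less.prems unfolding prime_free_def by blast
  qed
qed

text \<open>
  By submodularity the elements of \<open>[a, b]\<close> of rank \<open>r a\<close> are closed under joins, so one of
  greatest height, \<open>l\<close>, contains them all. A relative complement \<open>w\<close> of \<open>z \<inter> l\<close> in \<open>[a, z]\<close>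
  meets \<open>l\<close> in \<open>a\<close> and is therefore independent. Adding the loops \<open>z \<inter> l\<close> to \<open>w\<close> gives \<open>z\<close>
  without raising the rank.
\<close>

lemma prime_free_rank:
  assumes rk: "rank_function L join h r"
    and L: "a \<in> L" "b \<in> L" "a \<subseteq> b"
    and a: "r a = h a" and free: "prime_free L h r a b"
  obtains l where "l \<in> L" "a \<subseteq> l" "l \<subseteq> b"
    "\<And>z. z \<in> interval L a b \<Longrightarrow> r z = h a + (h z - h (z \<inter> l))"
proof -
  have r_le: "r x \<le> h x" if "x \<in> L" for x using rk that by (auto simp: rank_function_def)
  have r_mono: "r x \<le> r y" if "x \<in> L" "y \<in> L" "x \<subseteq> y" for x y
    using rk that by (auto simp: rank_function_def)
  have sub: "r (join x y) + r (x \<inter> y) \<le> r x + r y" if "x \<in> L" "y \<in> L" for x y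
    using rk that by (auto simp: rank_function_def)
  let ?S = "{z \<in> interval L a b. r z = r a}"
  have "finite ?S" by simp
  moreover have "a \<in> ?S" using L by (simp add: interval_def)
  ultimately obtain l where l: "l \<in> ?S" and max: "\<And>z. z \<in> ?S \<Longrightarrow> h z \<le> h l"
    by (rule element_of_max_height) blast
  have l': "l \<in> L" "a \<subseteq> l" "l \<subseteq> b" "r l = r a" using l by (auto simp: interval_def)
  have loops: "z \<subseteq> l" if "z \<in> interval L a b" "r z = r a" for z
  proof -
    have z: "z \<in> L" "a \<subseteq> z" "z \<subseteq> b" using that by (auto simp: interval_def)
    let ?j = "join z l"
    have j: "?j \<in> L" "z \<subseteq> ?j" "l \<subseteq> ?j" "?j \<subseteq> b"
      using z l' L join_upper[of z l] join_least[of z l b] join_closed[of z l] by auto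
    have "z \<inter> l \<in> L" using z l' Int_closed by auto
    then have "r a \<le> r (z \<inter> l)" using r_mono[of a] L z l' by simp
    then have "r ?j \<le> r a" using sub[of z l] z l' that by simp
    moreover have "r a \<le> r ?j" using j L z by (intro r_mono) auto
    ultimately have "?j \<in> ?S" using j z by (auto simp: interval_def)
    then have "l = ?j" using max j l' by (intro eq_if_h_ge) auto
    then show ?thesis using j by simp
  qed
  have "r z = h a + (h z - h (z \<inter> l))" if "z \<in> interval L a b" for z
  proof -
    have z: "z \<in> L" "a \<subseteq> z" "z \<subseteq> b" using that by (auto simp: interval_def)
    have zl: "z \<inter> l \<in> L" using z l' Int_closed by auto
    obtain w where w: "w \<in> L" "a \<subseteq> w" "w \<subseteq> z" "z \<inter> l \<inter> w = a" "join (z \<inter> l) w = z"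
      using relative_complement[of a z "z \<inter> l"] L z zl l' by auto
    have "w \<inter> l = a" using w by auto
    then have rw: "r w = h w"
      using w z loops by (intro independent_in_prime_free[OF rk L(1) l'(1) L(2) l'(2,3) a free]) auto
    have "r (z \<inter> l) \<le> r a" using r_mono[of "z \<inter> l" l] zl l' by simp
    then have "r z \<le> r w" using sub[of "z \<inter> l" w] zl w by simp
    moreover have "r w \<le> r z" using w z by (intro r_mono) auto
    moreover have "h z + h a = h (z \<inter> l) + h w" using modular[of "z \<inter> l" w] zl w by simp
    moreover have "h (z \<inter> l) \<le> h z" using zl z by (intro h_mono) auto
    ultimately show ?thesis using rw by simp
  qed
  then show thesis using that l' by blast
qed

lemma beta_act_block:
  assumes rk: "rank_function L join h r"
    and L: "a \<in> L" "b \<in> L" "a \<subseteq> b"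
    and a: "r a = h a" and free: "prime_free L h r a b"
  shows "(\<Sum>z\<in>interval L a b. beta_act q (var_x ^ (r b - r z) * var_y ^ nullity h r z))
       = var_x ^ (r b - r a) * var_y ^ (nullity h r b - nullity h r a)"
proof -
  obtain l where l: "l \<in> L" "a \<subseteq> l" "l \<subseteq> b"
    and rz: "\<And>z. z \<in> interval L a b \<Longrightarrow> r z = h a + (h z - h (z \<inter> l))"
    by (rule prime_free_rank[OF assms]) blast
  define s t where "s = h b - h l" and "t = h l - h a"
  have h: "h a \<le> h l" "h l \<le> h b" using h_mono l L by auto
  have rb: "r b = h a + s"
    using rz[of b] L l by (simp add: interval_def s_def Int_absorb1)
  have nz: "nullity h r z = h (z \<inter> l) - h a" if "z \<in> interval L a b" for z
  proof -
    have z: "z \<in> L" "a \<subseteq> z" using that by (auto simp: interval_def)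
    then have "h (z \<inter> l) \<le> h z" "h a \<le> h (z \<inter> l)"
      using Int_closed l L by (auto intro!: h_mono)
    then show ?thesis using rz[OF that] by (simp add: nullity_def)
  qed
  have "(\<Sum>z\<in>interval L a b. beta_act q (var_x ^ (r b - r z) * var_y ^ nullity h r z))
      = (\<Sum>z\<in>interval L a b. (\<lambda>i j. beta_act q (var_x ^ (s - i) * var_y ^ j))
           (h z - h (z \<inter> l)) (h (z \<inter> l) - h a))"
    by (intro sum.cong refl) (simp add: rz nz rb)
  also have "\<dots> = (\<Sum>i\<le>s. \<Sum>j\<le>t. of_nat (q_binomial q s i * q_binomial q t j * q ^ (i * (t - j)))
            * beta_act q (var_x ^ (s - i) * var_y ^ j))"
    unfolding s_def t_def using L l by (intro sum_interval_meet_heights)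
  also have "\<dots> = var_x ^ s * var_y ^ t"
    by (rule beta_act_inverts_rank_gen[OF q_pos])
  also have "s = r b - r a" using rb a by simp
  also have "t = nullity h r b - nullity h r a"
    using rb a h by (simp add: nullity_def s_def t_def)
  finally show ?thesis .
qed

lemma beta_act_rank_gen_poly:
  assumes rk: "rank_function L join h r" and P: "tutte_partition L h r P"
  shows "beta_act q (rank_gen_poly L h r) = tutte_poly h r P"
proof -
  let ?I = "\<lambda>(a, b). interval L a b"
  have part: "partition_on L (?I ` P)" using P by (simp add: tutte_partition_def)
  have block: "a \<in> L" "b \<in> L" "a \<subseteq> b" "r a = h a" "r b = r (\<Union>L)" "prime_free L h r a b"
    if "(a, b) \<in> P" for a b
    using P that by (auto simp: tutte_partition_def)
  \<comment> \<open>The sum over blocks becomes a sum over \<open>P\<close>: a block determines its endpoints, as it contains them.\<close>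
  have inj: "inj_on ?I P"
  proof (rule inj_onI, clarify)
    fix a b a' b' assume "(a, b) \<in> P" "(a', b') \<in> P" and eq: "interval L a b = interval L a' b'"
    then have "a \<in> interval L a b" "b \<in> interval L a b"
        "a' \<in> interval L a' b'" "b' \<in> interval L a' b'"
      using block(1-3)[of a b] block(1-3)[of a' b'] by (auto simp: interval_def)
    then have "a \<in> interval L a' b'" "b \<in> interval L a' b'" "a' \<in> interval L a b" "b' \<in> interval L a b"
      by (simp_all only: eq)
    then show "a = a' \<and> b = b'" by (auto simp: interval_def)
  qed
  have "(\<Sum>z\<in>L. g z) = (\<Sum>B\<in>?I ` P. \<Sum>z\<in>B. g z)" for g :: "'a set \<Rightarrow> int poly poly"
  proof -
    have "(\<Sum>z\<in>\<Union>(?I ` P). g z) = (\<Sum>B\<in>?I ` P. \<Sum>z\<in>B. g z)"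
      using part by (subst sum.Union_disjoint) (auto simp: partition_on_def disjoint_def)
    then show ?thesis using part by (simp add: partition_on_def)
  qed
  then have sum_P: "(\<Sum>z\<in>L. g z) = (\<Sum>(a, b)\<in>P. \<Sum>z\<in>interval L a b. g z)"
    for g :: "'a set \<Rightarrow> int poly poly"
    unfolding sum.reindex[OF inj] by (simp add: case_prod_unfold)
  have "beta_act q (rank_gen_poly L h r)
      = (\<Sum>(a, b)\<in>P. \<Sum>z\<in>interval L a b. beta_act q (var_x ^ (r (\<Union>L) - r z) * var_y ^ nullity h r z))"
    unfolding rank_gen_poly_def beta_act_sum by (rule sum_P)
  also have "\<dots> = (\<Sum>(a, b)\<in>P. var_x ^ (r b - r a) * var_y ^ (nullity h r b - nullity h r a))"
  proof (rule sum.cong[OF refl], clarify)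
    fix a b assume "(a, b) \<in> P"
    note ab = block[OF this]
    show "(\<Sum>z\<in>interval L a b. beta_act q (var_x ^ (r (\<Union>L) - r z) * var_y ^ nullity h r z))
        = var_x ^ (r b - r a) * var_y ^ (nullity h r b - nullity h r a)"
      using beta_act_block[OF rk ab(1,2,3,4,6)] unfolding ab(5) .
  qed
  finally show ?thesis by (simp add: tutte_poly_def)
qed

end

section \<open>Subsets and subspaces\<close>

lemma q_lattice_Pow:
  assumes "finite E"
  shows "q_lattice (Pow E) (\<union>) card 1"
proof
  fix x y assume xy: "x \<in> Pow E" "y \<in> Pow E"
  then have fin: "finite x" "finite y" using assms finite_subset by auto
  show "card (x \<union> y) + card (x \<inter> y) = card x + card y"
    using card_Un_Int[OF fin] by simp
  show "x \<subset> y \<Longrightarrow> card x < card y" using fin by (simp add: psubset_card_mono)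
  assume sub: "x \<subseteq> y"
  have "{z \<in> Pow E. x \<subseteq> z \<and> z \<subseteq> y \<and> card z = Suc (card x)} = (\<lambda>e. insert e x) ` (y - x)"
  proof (intro equalityI subsetI)
    fix z assume z: "z \<in> {z \<in> Pow E. x \<subseteq> z \<and> z \<subseteq> y \<and> card z = Suc (card x)}"
    then have "card (z - x) = 1" using fin by (simp add: card_Diff_subset)
    then obtain e where "z - x = {e}" using card_1_singletonE by blast
    then have "z = insert e x" "e \<in> y - x" using z by auto
    then show "z \<in> (\<lambda>e. insert e x) ` (y - x)" by blast
  next
    fix z assume "z \<in> (\<lambda>e. insert e x) ` (y - x)"
    then obtain e where "e \<in> y - x" "z = insert e x" by blast
    then show "z \<in> {z \<in> Pow E. x \<subseteq> z \<and> z \<subseteq> y \<and> card z = Suc (card x)}"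
      using xy sub fin by auto
  qed
  moreover have "inj_on (\<lambda>e. insert e x) (y - x)" by (auto simp: inj_on_def)
  ultimately show "card {z \<in> Pow E. x \<subseteq> z \<and> z \<subseteq> y \<and> card z = Suc (card x)} = q_int 1 (card y - card x)"
    using sub fin by (simp add: card_image card_Diff_subset q_int_def)
qed (use assms in auto)

context finite_dimensional_vector_space
begin

lemma card_span_insert:
  assumes fin: "finite (UNIV :: 'a set)" and S: "subspace S" "finite S" and v: "v \<notin> S"
  shows "card (span (insert v S)) = CARD('a) * card S"
proof -
  let ?f = "\<lambda>(c, s). scale c v + s"
  have inj: "inj_on ?f (UNIV \<times> S)"
  proof (rule inj_onI, clarify)
    fix c s c' s' assume s: "s \<in> S" "s' \<in> S" and eq: "scale c v + s = scale c' v + s'"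
    then have *: "scale (c - c') v = s' - s" by (simp add: algebra_simps)
    have "c = c'"
    proof (rule ccontr)
      assume "c \<noteq> c'"
      then have "v = scale (inverse (c - c')) (s' - s)" by (simp flip: *)
      then show False using v s S subspace_diff subspace_scale by metis
    qed
    then show "c = c' \<and> s = s'" using eq by simp
  qed
  have "span (insert v S) = ?f ` (UNIV \<times> S)"
  proof (intro equalityI subsetI)
    fix x assume "x \<in> span (insert v S)"
    then obtain k where "x - scale k v \<in> S"
      using S(1) by (auto simp: span_breakdown_eq span_eq_iff[THEN iffD2])
    then show "x \<in> ?f ` (UNIV \<times> S)" by (intro image_eqI[of _ _ "(k, x - scale k v)"]) auto
  qed (auto intro: span_add span_scale span_base)
  then show ?thesis using inj by (simp add: card_image card_cartesian_product)
qed

lemma finite_carrier: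
  assumes fin: "finite (UNIV :: 'a set)"
  shows "finite (UNIV :: 'b set)"
proof -
  have "finite (span B)" if "finite B" for B
    using that
  proof induction
    case (insert v B)
    have "span (insert v B) \<subseteq> (\<lambda>(c, s). scale c v + s) ` (UNIV \<times> span B)"
    proof
      fix x assume "x \<in> span (insert v B)"
      then obtain k where "x - scale k v \<in> span B" by (auto simp: span_breakdown_eq)
      then show "x \<in> (\<lambda>(c, s). scale c v + s) ` (UNIV \<times> span B)"
        by (intro image_eqI[of _ _ "(k, x - scale k v)"]) auto
    qed
    then show ?case using insert fin by (meson finite_SigmaI finite_imageI finite_subset)
  qed simp
  then show ?thesis using finite_Basis span_Basis by metis
qed

lemma finite_set_of_sets:
  assumes fin: "finite (UNIV :: 'a set)"
  shows "finite (A :: 'b set set)"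
proof -
  have "finite (Pow (UNIV :: 'b set))"
    by (rule finite_Pow_iff[THEN iffD2, OF finite_carrier[OF fin]])
  then show ?thesis by (rule rev_finite_subset) blast
qed

lemma card_subspace:
  assumes fin: "finite (UNIV :: 'a set)" and "subspace S"
  shows "card S = CARD('a) ^ dim S"
proof -
  obtain B where B: "B \<subseteq> S" "independent B" "S \<subseteq> span B" "card B = dim S"
    using basis_exists[of S] by blast
  have finS: "finite T" for T :: "'b set" using finite_subset[OF subset_UNIV finite_carrier[OF fin]] .
  have "card (span B) = CARD('a) ^ card B" if "independent B" for B
    using finS[of B] that
  proof induction
    case (insert v B)
    then have v: "v \<notin> span B" "independent B" by (auto simp: independent_insert)
    have "span (insert v (span B)) = span (insert v B)"
      by (simp add: span_eq) (meson insertI1 insert_subset span_base span_mono span_superset subset_insertI subset_trans)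
    then show ?case
      using card_span_insert[OF fin subspace_span finS v(1)] insert v by simp
  qed simp
  then show ?thesis using B assms span_minimal[of B S] by (metis subset_antisym)
qed

text \<open>
  The sets \<open>Z - U\<close>, for the covers \<open>Z\<close> of \<open>U\<close> below \<open>W\<close>, partition \<open>W - U\<close>, since \<open>U\<close> and one
  vector \<open>v\<close> outside \<open>U\<close> span the only such \<open>Z\<close> that contains \<open>v\<close>. Comparing cardinalities
  gives the number of covers as \<open>(q\<^bsup>dim W\<^esup> - q\<^bsup>dim U\<^esup>) / (q\<^bsup>dim U + 1\<^esup> - q\<^bsup>dim U\<^esup>)\<close>.
\<close>

lemma card_covers_subspace:
  assumes fin: "finite (UNIV :: 'a set)" and U: "subspace U" and W: "subspace W" and sub: "U \<subseteq> W"
  shows "card {Z. subspace Z \<and> U \<subseteq> Z \<and> Z \<subseteq> W \<and> dim Z = Suc (dim U)}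
       = q_int CARD('a) (dim W - dim U)"
proof -
  let ?C = "{Z. subspace Z \<and> U \<subseteq> Z \<and> Z \<subseteq> W \<and> dim Z = Suc (dim U)}"
  let ?q = "CARD('a)"
  have finS: "finite T" for T :: "'b set" using finite_subset[OF subset_UNIV finite_carrier[OF fin]] .
  have finC: "finite ?C" by (rule finite_set_of_sets[OF fin])
  have cover: "span (insert v U) = Z" if "Z \<in> ?C" "v \<in> Z - U" for v Z
  proof (rule subspace_dim_equal)
    show "span (insert v U) \<subseteq> Z" using that by (intro span_minimal) auto
    show "dim Z \<le> dim (span (insert v U))"
      using that U by (simp add: dim_insert span_eq_iff[THEN iffD2])
  qed (use that in auto)
  have disj: "pairwise (\<lambda>Z Z'. disjnt (Z - U) (Z' - U)) ?C"
  proof (rule pairwiseI)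
    fix Z Z' assume Z: "Z \<in> ?C" "Z' \<in> ?C" "Z \<noteq> Z'"
    have "v \<notin> Z' - U" if "v \<in> Z - U" for v
      using Z that cover[of Z v] cover[of Z' v] by metis
    then show "disjnt (Z - U) (Z' - U)" by (auto simp: disjnt_iff)
  qed
  have union: "(\<Union>Z\<in>?C. Z - U) = W - U"
  proof (intro equalityI subsetI)
    fix v assume v: "v \<in> W - U"
    have "span (insert v U) \<in> ?C"
      using v U W sub span_minimal[of "insert v U" W] span_superset[of "insert v U"]
      by (auto simp: dim_insert span_eq_iff[THEN iffD2])
    moreover have "v \<in> span (insert v U) - U" using v by (simp add: span_base)
    ultimately show "v \<in> (\<Union>Z\<in>?C. Z - U)" by blast
  qed auto
  have card_diff: "card (Z - U) = ?q ^ dim Z - ?q ^ dim U" if "subspace Z" "U \<subseteq> Z" for Z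
    using that by (simp add: card_Diff_subset finS card_subspace[OF fin] U)
  have "?q ^ dim W - ?q ^ dim U = card (\<Union>Z\<in>?C. Z - U)"
    using card_diff[OF W sub] union by simp
  also have "\<dots> = (\<Sum>Z\<in>?C. card (Z - U))"
    using finC finS disj by (intro card_UN_disjoint) (auto simp: pairwise_def disjnt_def)
  also have "\<dots> = card ?C * (?q ^ Suc (dim U) - ?q ^ dim U)"
    by (simp add: card_diff)
  finally have count: "?q ^ dim W - ?q ^ dim U = card ?C * (?q ^ Suc (dim U) - ?q ^ dim U)" .
  have q: "?q \<ge> 2"
    using card_mono[OF fin, of "{0, 1}"] by simp
  have geometric: "(?q - 1) * q_int ?q n = ?q ^ n - 1" for n
  proof -
    have "int ((?q - 1) * q_int ?q n) = int (?q ^ n - 1)"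
      using q power_diff_1_eq[of "int ?q" n] by (simp add: q_int_def of_nat_diff)
    then show ?thesis by linarith
  qed
  have "dim U \<le> dim W" using sub by (rule dim_subset)
  then have W: "?q ^ dim W = ?q ^ dim U * ?q ^ (dim W - dim U)" by (simp only: le_add_diff_inverse flip: power_add)
  have "?q ^ dim W - ?q ^ dim U = (?q ^ dim U * (?q - 1)) * q_int ?q (dim W - dim U)"
    unfolding W mult.assoc geometric by (simp add: diff_mult_distrib2)
  moreover have "?q ^ Suc (dim U) - ?q ^ dim U = ?q ^ dim U * (?q - 1)"
    by (simp only: power_Suc2 diff_mult_distrib2 mult_1_right)
  ultimately have "(?q ^ dim U * (?q - 1)) * q_int ?q (dim W - dim U)
      = (?q ^ dim U * (?q - 1)) * card ?C"
    using count by (simp only: mult.commute)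
  then show ?thesis using q by simp
qed

lemma q_lattice_subspaces:
  assumes fin: "finite (UNIV :: 'a set)"
  shows "q_lattice {U. subspace U} (\<lambda>U W. span (U \<union> W)) dim CARD('a)"
proof
  show "0 < CARD('a)" using fin by (simp add: card_gt_0_iff)
  show "finite {U. subspace U}" by (rule finite_set_of_sets[OF fin])
  fix U W assume *: "U \<in> {U. subspace U}" "W \<in> {U. subspace U}"
  then show "U \<inter> W \<in> {U. subspace U}" by (simp add: subspace_inter)
  show "span (U \<union> W) \<in> {U. subspace U}" by simp
  show "U \<union> W \<subseteq> span (U \<union> W)" by (rule span_superset)
  show "span (U \<union> W) \<subseteq> Z" if "Z \<in> {U. subspace U}" "U \<subseteq> Z" "W \<subseteq> Z" for Z
    using that by (intro span_minimal) auto
  show "dim (span (U \<union> W)) + dim (U \<inter> W) = dim U + dim W"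
    using * dim_sums_Int[of U W] by (simp add: span_Un span_eq_iff[THEN iffD2] del: dim_span)
  show "dim U < dim W" if "U \<subset> W"
    using * that by (intro dim_psubset) (simp add: span_eq_iff[THEN iffD2])
  show "card {Z \<in> {U. subspace U}. U \<subseteq> Z \<and> Z \<subseteq> W \<and> dim Z = Suc (dim U)}
      = q_int CARD('a) (dim W - dim U)" if "U \<subseteq> W"
    using * that card_covers_subspace[OF fin, of U W] by simp
qed

end

theorem corollary68:
  shows "(\<forall>(E :: 'a set) r P.
            matroid E r \<and> tutte_partition (Pow E) card r P \<longrightarrow>
              beta_act 1 (rank_gen_poly (Pow E) card r) = tutte_poly card r P \<and>
              (\<forall>P'. tutte_partition (Pow E) card r P' \<longrightarrow>
                 tutte_poly card r P' = tutte_poly card r P))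
       \<and> (\<forall>(scale :: 'k::{field,finite} \<Rightarrow> 'v::ab_group_add \<Rightarrow> 'v) B r P.
            q_matroid scale B r \<and>
            tutte_partition (subspaces scale) (vector_space.dim scale) r P \<longrightarrow>
              beta_act CARD('k) (rank_gen_poly (subspaces scale) (vector_space.dim scale) r)
                = tutte_poly (vector_space.dim scale) r P \<and>
              (\<forall>P'. tutte_partition (subspaces scale) (vector_space.dim scale) r P' \<longrightarrow>
                 tutte_poly (vector_space.dim scale) r P'
                   = tutte_poly (vector_space.dim scale) r P))"
proof -
  have "beta_act 1 (rank_gen_poly (Pow E) card r) = tutte_poly card r P"
    if "matroid E r" "tutte_partition (Pow E) card r P" for E :: "'a set" and r P
    using that by (intro q_lattice.beta_act_rank_gen_poly[OF q_lattice_Pow])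
      (auto simp: matroid_def)
  moreover have "beta_act CARD('k) (rank_gen_poly (subspaces scale) (vector_space.dim scale) r)
                = tutte_poly (vector_space.dim scale) r P"
    if M: "q_matroid scale B r" and P: "tutte_partition (subspaces scale) (vector_space.dim scale) r P"
    for scale :: "'k \<Rightarrow> 'v \<Rightarrow> 'v" and B r P
  proof -
    interpret q_matroid scale B r by (rule M)
    show ?thesis
      using P unfolding subspaces_def
      by (intro q_lattice.beta_act_rank_gen_poly[OF q_lattice_subspaces] rank) simp_all
  qed
  ultimately show ?thesis by metis
qed

end
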